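(* Let $(X,d)$ be a complete metric space, let $\mathscr{G}$ be a locally uniformly upper semicontinuous (LUUS) generalized process in $X$ composed of continuous functions and asymptotically autonomous for $\mathcal{A}=\{\mathcal{A}(t)\}_{t\in\mathbb{R}}$, a quasi-invariant global selected pullback attractor of $\mathscr{G}$, and let $\mathcal{A}_\infty$ be the global attractor of the corresponding autonomous problem. If $$\lim_{t\to\infty}\mathrm{dist}(\mathcal{A}(t),\mathcal{A}_\infty)=0,$$ then the selected pullback attractor $\mathcal{A}$ is forward compact, i.e., $\overline{\bigcup_{s\ge t}\mathcal{A}(s)}$ is compact for all $t\in\mathbb{R}$.
   Context: Let $(X,d)$ be a complete metric space. For nonempty $A,B\subset X$: $\mathrm{dist}(A,B)=\sup_{a\in A}\inf_{b\in B}d(a,b)$; for $\varepsilon>0$, $\mathcal{O}_\varepsilon(A)=\{z\in X:\inf_{a\in A}d(z,a)<\varepsilon\}$. Generalized process: a family $\mathscr{G}=\{\mathscr{G}(\tau)\}_{\tau\in\mathbb{R}}$ of sets $\mathscr{G}(\tau)$ consisting of functions $\varphi:[\tau,\infty)\to X$ (called solutions) such that: (C1) for each $\tau\in\mathbb{R}$ and $z\in X$ there is at least one $\varphi\in\mathscr{G}(\tau)$ with $\varphi(\tau)=z$; (C2) if $\varphi\in\mathscr{G}(\tau)$ and $s\ge 0$, then $\varphi|_{[\tau+s,\infty)}\in\mathscr{G}(\tau+s)$; (C3) if $\{\varphi_j\}_{j\in\mathbb{N}}\subset\mathscr{G}(\tau)$ and $\varphi_j(\tau)\to z$, then there are a subsequence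 $\{\varphi_{j_k}\}$ and $\varphi\in\mathscr{G}(\tau)$ with $\varphi(\tau)=z$ and $\varphi_{j_k}(t)\to\varphi(t)$ as $k\to\infty$ for each $t\ge\tau$. $\mathscr{G}$ is locally uniformly upper semicontinuous (LUUS) if: whenever $\varphi_j\in\mathscr{G}(\tau)$ for all $j\in\mathbb{N}$ and $\varphi_j(\tau)\to z$, there are $\varphi\in\mathscr{G}(\tau)$ with $\varphi(\tau)=z$ and a subsequence $\{\varphi_{j_k}\}$ with $\varphi_{j_k}\to\varphi$ uniformly on compact subsets of $[\tau,\infty)$. A complete orbit (complete trajectory) through $x\in X$ at $\tau\in\mathbb{R}$ is a map $\psi:\mathbb{R}\to X$ with $\psi(\tau)=x$ and $\psi|_{[\tau+s,\infty)}\in\mathscr{G}(\tau+s)$ for all $s\in\mathbb{R}$. A family $\mathcal{A}=\{\mathcal{A}(t)\}_{t\in\mathbb{R}}$ of subsets of $X$ is quasi-invariant if for each $\tau\in\mathbb{R}$ and $z\in\mathcal{A}(\tau)$ there is a complete orbit $\psi$ through $z$ at $\tau$ with $\psi(t)\in\mathcal{A}(t)$ for all $t\in\mathbb{R}$. $\mathcal{A}$ select pullback attracts $x\in X$ at time $t\in\mathbb{R}$ if for every $\varepsilon>0$ there is $\tau_0\le t$ such that for all $\tau\le\tau_0$ there is $\varphi_\tau\in\mathscr{G}(\tau)$ with $\varphi_\tau(\tau)=x$ and $\varphi_\tau(t)\in\mathcal{O}_\varepsilon(\mathcal{A}(t))$. A global selected pullback attractor of $\mathscr{G}$ is a family of nonempty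 compact subsets $\mathcal{A}(t)$, $t\in\mathbb{R}$, of $X$ which select pullback attracts every $x\in X$ at every time $t\in\mathbb{R}$. Autonomous problem: it is given by a set $\mathcal{S}$ of functions $\varphi:[0,\infty)\to X$ (its solutions) such that every $z\in X$ is the initial value $\varphi(0)$ of some $\varphi\in\mathcal{S}$ and $\varphi(\cdot+s)\in\mathcal{S}$ for $\varphi\in\mathcal{S}$, $s\ge0$. Its multivalued semigroup is $G(t,B)=\{\varphi(t):\varphi\in\mathcal{S},\ \varphi(0)\in B\}$, $t\ge 0$, $B\subset X$. Its global attractor $\mathcal{A}_\infty$ is a nonempty compact set with $\mathcal{A}_\infty\subset G(t,\mathcal{A}_\infty)$ for all $t\ge0$ and $\mathrm{dist}(G(t,B),\mathcal{A}_\infty)\to0$ as $t\to\infty$ for every nonempty bounded $B\subset X$. $\mathscr{G}$ is asymptotically autonomous for $\mathcal{A}$ (a quasi-invariant global selected pullback attractor), with corresponding autonomous problem $\mathcal{S}$, if: for every sequence of times $\tau\to\infty$ and points $x_\tau\in\mathcal{A}(\tau)$ with $x_\tau\to x_0$ in $X$ as $\tau\to\infty$, and all complete trajectories $\varphi_\tau$ with $\varphi_\tau(\tau)=x_\tau$ and $\varphi_\tau(s)\in\mathcal{A}(s)$ for all $s\in\mathbb{R}$, there is a solution $\varphi\in\mathcal{S}$ of the autonomous problem with $\varphi(0)=x_0$ and $\varphi_\tau(t+\tau)\to\varphi(t)$ as $\tau\to\infty$ along the sequence, for each $t\ge0$. *)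

theory Defs
  imports "HOL-Analysis.Analysis"
begin

text \<open>The complete metric space \<open>X\<close> is a type of class \<^class>\<open>complete_space\<close>.
  A map \<open>[\<tau>, \<infinity>) \<rightarrow> X\<close> is an element of \<open>extensional {\<tau>..}\<close>, i.e. a function on \<open>\<real>\<close> with the
  fixed value \<^const>\<open>undefined\<close> outside \<open>{\<tau>..}\<close>, so that restriction is \<^const>\<open>restrict\<close> and
  equality is equality on \<open>{\<tau>..}\<close>.\<close>

text \<open>The Hausdorff semidistance takes values in \<open>[0, \<infinity>]\<close>, since the supremum may be infinite
  when \<open>A\<close> is unbounded.\<close>

definition hsemidist :: "'a::metric_space set \<Rightarrow> 'a set \<Rightarrow> ennreal" where
  "hsemidist A B = (SUP a\<in>A. INF b\<in>B. ennreal (dist a b))"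

text \<open>Only used for nonempty \<open>A\<close>, where \<^const>\<open>infdist\<close> is the infimum of the distances.\<close>

definition neighborhood :: "real \<Rightarrow> 'a::metric_space set \<Rightarrow> 'a set" where
  "neighborhood \<epsilon> A = {z. infdist z A < \<epsilon>}"

definition generalized_process :: "(real \<Rightarrow> (real \<Rightarrow> 'a::metric_space) set) \<Rightarrow> bool" where
  "generalized_process G \<longleftrightarrow>
     (\<forall>\<tau>. G \<tau> \<subseteq> extensional {\<tau>..}) \<and>
     (\<forall>\<tau> z. \<exists>\<phi>\<in>G \<tau>. \<phi> \<tau> = z) \<and>
     (\<forall>\<tau> s. \<forall>\<phi>\<in>G \<tau>. s \<ge> 0 \<longrightarrow> restrict \<phi> {\<tau> + s..} \<in> G (\<tau> + s)) \<and>
     (\<forall>\<tau> (\<phi> :: nat \<Rightarrow> real \<Rightarrow> 'a) z.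
        (\<forall>j. \<phi> j \<in> G \<tau>) \<longrightarrow> (\<lambda>j. \<phi> j \<tau>) \<longlonglongrightarrow> z \<longrightarrow>
        (\<exists>r \<phi>'. strict_mono (r :: nat \<Rightarrow> nat) \<and> \<phi>' \<in> G \<tau> \<and> \<phi>' \<tau> = z \<and>
           (\<forall>t\<ge>\<tau>. (\<lambda>k. \<phi> (r k) t) \<longlonglongrightarrow> \<phi>' t)))"

definition LUUS :: "(real \<Rightarrow> (real \<Rightarrow> 'a::metric_space) set) \<Rightarrow> bool" where
  "LUUS G \<longleftrightarrow>
     (\<forall>\<tau> (\<phi> :: nat \<Rightarrow> real \<Rightarrow> 'a) z.
        (\<forall>j. \<phi> j \<in> G \<tau>) \<longrightarrow> (\<lambda>j. \<phi> j \<tau>) \<longlonglongrightarrow> z \<longrightarrow>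
        (\<exists>\<phi>' r. \<phi>' \<in> G \<tau> \<and> \<phi>' \<tau> = z \<and> strict_mono (r :: nat \<Rightarrow> nat) \<and>
           (\<forall>K. compact K \<longrightarrow> K \<subseteq> {\<tau>..} \<longrightarrow>
              uniform_limit K (\<lambda>k. \<phi> (r k)) \<phi>' sequentially)))"

definition composed_of_continuous :: "(real \<Rightarrow> (real \<Rightarrow> 'a::metric_space) set) \<Rightarrow> bool" where
  "composed_of_continuous G \<longleftrightarrow> (\<forall>\<tau>. \<forall>\<phi>\<in>G \<tau>. continuous_on {\<tau>..} \<phi>)"

definition complete_orbit ::
    "(real \<Rightarrow> (real \<Rightarrow> 'a::metric_space) set) \<Rightarrow> 'a \<Rightarrow> real \<Rightarrow> (real \<Rightarrow> 'a) \<Rightarrow> bool" where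
  "complete_orbit G x \<tau> \<psi> \<longleftrightarrow> \<psi> \<tau> = x \<and> (\<forall>s. restrict \<psi> {\<tau> + s..} \<in> G (\<tau> + s))"

definition quasi_invariant ::
    "(real \<Rightarrow> (real \<Rightarrow> 'a::metric_space) set) \<Rightarrow> (real \<Rightarrow> 'a set) \<Rightarrow> bool" where
  "quasi_invariant G A \<longleftrightarrow>
     (\<forall>\<tau>. \<forall>z\<in>A \<tau>. \<exists>\<psi>. complete_orbit G z \<tau> \<psi> \<and> (\<forall>t. \<psi> t \<in> A t))"

definition select_pullback_attracts ::
    "(real \<Rightarrow> (real \<Rightarrow> 'a::metric_space) set) \<Rightarrow> (real \<Rightarrow> 'a set) \<Rightarrow> 'a \<Rightarrow> real \<Rightarrow> bool" where
  "select_pullback_attracts G A x t \<longleftrightarrow>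
     (\<forall>\<epsilon>>0. \<exists>\<tau>\<^sub>0\<le>t. \<forall>\<tau>\<le>\<tau>\<^sub>0. \<exists>\<phi>\<in>G \<tau>. \<phi> \<tau> = x \<and> \<phi> t \<in> neighborhood \<epsilon> (A t))"

definition global_selected_pullback_attractor ::
    "(real \<Rightarrow> (real \<Rightarrow> 'a::metric_space) set) \<Rightarrow> (real \<Rightarrow> 'a set) \<Rightarrow> bool" where
  "global_selected_pullback_attractor G A \<longleftrightarrow>
     (\<forall>t. A t \<noteq> {} \<and> compact (A t)) \<and> (\<forall>x t. select_pullback_attracts G A x t)"

definition autonomous_problem :: "(real \<Rightarrow> 'a::metric_space) set \<Rightarrow> bool" where
  "autonomous_problem S \<longleftrightarrow>
     S \<subseteq> extensional {0..} \<and>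
     (\<forall>z. \<exists>\<phi>\<in>S. \<phi> 0 = z) \<and>
     (\<forall>\<phi>\<in>S. \<forall>s\<ge>0. restrict (\<lambda>t. \<phi> (t + s)) {0..} \<in> S)"

definition multivalued_semigroup ::
    "(real \<Rightarrow> 'a::metric_space) set \<Rightarrow> real \<Rightarrow> 'a set \<Rightarrow> 'a set" where
  "multivalued_semigroup S t B = {\<phi> t |\<phi>. \<phi> \<in> S \<and> \<phi> 0 \<in> B}"

definition global_attractor :: "(real \<Rightarrow> 'a::metric_space) set \<Rightarrow> 'a set \<Rightarrow> bool" where
  "global_attractor S K \<longleftrightarrow>
     K \<noteq> {} \<and> compact K \<and>
     (\<forall>t\<ge>0. K \<subseteq> multivalued_semigroup S t K) \<and>
     (\<forall>B. B \<noteq> {} \<longrightarrow> bounded B \<longrightarrow>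
        ((\<lambda>t. hsemidist (multivalued_semigroup S t B) K) \<longlongrightarrow> 0) at_top)"

definition asymptotically_autonomous ::
    "(real \<Rightarrow> (real \<Rightarrow> 'a::metric_space) set) \<Rightarrow> (real \<Rightarrow> 'a set) \<Rightarrow> (real \<Rightarrow> 'a) set \<Rightarrow> bool" where
  "asymptotically_autonomous G A S \<longleftrightarrow>
     (\<forall>(\<tau> :: nat \<Rightarrow> real) x x\<^sub>0 \<psi>.
        filterlim \<tau> at_top sequentially \<longrightarrow>
        (\<forall>n. x n \<in> A (\<tau> n)) \<longrightarrow> x \<longlonglongrightarrow> x\<^sub>0 \<longrightarrow>
        (\<forall>n. complete_orbit G (x n) (\<tau> n) (\<psi> n) \<and> (\<forall>s. \<psi> n s \<in> A s)) \<longrightarrow>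
        (\<exists>\<phi>\<in>S. \<phi> 0 = x\<^sub>0 \<and> (\<forall>t\<ge>0. (\<lambda>n. \<psi> n (t + \<tau> n)) \<longlonglongrightarrow> \<phi> t)))"

definition forward_compact :: "(real \<Rightarrow> 'a::metric_space set) \<Rightarrow> bool" where
  "forward_compact A \<longleftrightarrow> (\<forall>t. compact (closure (\<Union>s\<in>{t..}. A s)))"

end

theory Submission
  imports Defs
begin

text \<open>Along times tending to infinity the sections approach the compact set \<open>A_inf\<close>, so only a
  bounded range of times matters. There every point \<open>x n \<in> A (s n)\<close>, \<open>s n \<in> {t..T}\<close>, lies on
  a complete orbit starting in the compact section \<open>A t\<close>; LUUS makes a subsequence of these orbits
  converge uniformly on \<open>{t..T}\<close> to a continuous solution, which gives convergence of the points
  even though the times \<open>s n\<close> vary.\<close>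

text \<open>A sequence in \<open>closure U\<close> is shadowed by one in \<open>U\<close> at
  distance below 1/(n+1), so the two converge along the same subsequences to the same limit. Hence
  it is enough to test sequences in \<open>U\<close>, and their limits need not lie in
  \<open>U\<close>.\<close>

lemma compact_closure_if_sequences:
  fixes U :: "'a::metric_space set"
  assumes sub: "\<And>x :: nat \<Rightarrow> 'a. (\<And>n. x n \<in> U) \<Longrightarrow> \<exists>l r. strict_mono (r :: nat \<Rightarrow> nat) \<and> (x \<circ> r) \<longlonglongrightarrow> l"
  shows "compact (closure U)"
  unfolding compact_def
proof (intro allI impI)
  fix y :: "nat \<Rightarrow> 'a"
  assume y: "\<forall>n. y n \<in> closure U"
  have "\<exists>x\<in>U. dist x (y n) < inverse (real (Suc n))" for n
    using y by (simp add: closure_approachable)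
  then obtain x where x: "\<And>n. x n \<in> U" "\<And>n. dist (x n) (y n) < inverse (real (Suc n))"
    by metis
  obtain l r where r: "strict_mono (r :: nat \<Rightarrow> nat)" and l: "(x \<circ> r) \<longlonglongrightarrow> l"
    using sub[of x] x(1) by blast
  have lim: "(\<lambda>n. inverse (real (Suc (r n))) + dist (x (r n)) l) \<longlonglongrightarrow> 0"
    using LIMSEQ_subseq_LIMSEQ[OF LIMSEQ_inverse_real_of_nat r] l
    by (intro tendsto_add_zero) (simp_all add: o_def tendsto_dist_iff[symmetric])
  have bound: "dist (y (r n)) l \<le> inverse (real (Suc (r n))) + dist (x (r n)) l" for n
    using x(2)[of "r n"] by metric
  have "(\<lambda>n. dist (y (r n)) l) \<longlonglongrightarrow> 0"
    by (rule Lim_null_comparison[OF always_eventually lim]) (simp only: real_norm_def abs_of_nonneg[OF zero_le_dist] bound simp_thms)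
  then have "(y \<circ> r) \<longlonglongrightarrow> l"
    by (simp add: o_def tendsto_dist_iff[symmetric])
  moreover have "l \<in> closure U"
    using x(1) l unfolding closure_sequential by (intro exI[of _ "x \<circ> r"]) simp
  ultimately show "\<exists>l\<in>closure U. \<exists>r. strict_mono r \<and> (y \<circ> r) \<longlonglongrightarrow> l"
    using r by blast
qed

text \<open>In a complete space only total boundedness is at stake. A finite
  \<open>e / 3\<close>-net of \<open>K\<close> is an \<open>e\<close>-net of
  \<open>closure U\<close>: one third each goes to the steps from the closure to \<open>U\<close>,
  from \<open>U\<close> to \<open>K\<close>, and from \<open>K\<close> to the net. The set
  \<open>K\<close> may change with \<open>e\<close>, which is what lets a tail of the family be
  absorbed by a single compact set.\<close>

lemma compact_closure_if_near_compact:
  fixes U :: "'a::complete_space set"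
  assumes near: "\<And>e. e > 0 \<Longrightarrow> \<exists>K. compact K \<and> (\<forall>u\<in>U. \<exists>k\<in>K. dist u k < e)"
  shows "compact (closure U)"
  unfolding compact_eq_totally_bounded
proof (intro conjI allI impI)
  show "complete (closure U)"
    by (simp add: complete_eq_closed)
  fix e :: real
  assume "0 < e"
  then have e: "0 < e / 3" by simp
  obtain K where K: "compact K" "\<forall>u\<in>U. \<exists>k\<in>K. dist u k < e / 3"
    using near[OF e] by blast
  obtain F where F: "finite F" "K \<subseteq> (\<Union>x\<in>F. ball x (e / 3))"
    using K(1) e unfolding compact_eq_totally_bounded by blast
  have "z \<in> (\<Union>x\<in>F. ball x e)" if z: "z \<in> closure U" for z
  proof -
    obtain u where u: "u \<in> U" "dist u z < e / 3"
      using z e unfolding closure_approachable by blast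
    obtain k where k: "k \<in> K" "dist u k < e / 3" using K(2) u(1) by blast
    obtain f where f: "f \<in> F" "dist f k < e / 3" using F(2) k(1) by auto
    have "dist f z < e" using u(2) k(2) f(2) by metric
    then show ?thesis using f(1) by auto
  qed
  then show "\<exists>F. finite F \<and> closure U \<subseteq> (\<Union>x\<in>F. ball x e)"
    using F(1) by blast
qed

lemma hsemidist_lessD:
  assumes "hsemidist A B < ennreal e" and "a \<in> A"
  obtains b where "b \<in> B" "dist a b < e"
proof -
  have "(INF b\<in>B. ennreal (dist a b)) < ennreal e"
    using assms unfolding hsemidist_def by (meson SUP_upper le_less_trans)
  then obtain b where "b \<in> B" "ennreal (dist a b) < ennreal e"
    unfolding INF_less_iff by blast
  then show ?thesis using that by (simp add: ennreal_less_iff)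
qed

text \<open>The intermediate point \<open>g (s n)\<close> splits the distance: uniformity controls
  the first half although the argument moves with \<open>n\<close>, and continuity of the limit
  \<open>g\<close> controls the second.\<close>

lemma uniform_limit_tendsto_diagonal:
  fixes f :: "nat \<Rightarrow> 'b::metric_space \<Rightarrow> 'a::metric_space"
  assumes unif: "uniform_limit K f g sequentially" and cont: "continuous_on K g"
    and s: "\<And>n. s n \<in> K" "s \<longlonglongrightarrow> l" "l \<in> K"
  shows "(\<lambda>n. f n (s n)) \<longlonglongrightarrow> g l"
proof (rule metric_LIMSEQ_I)
  fix e :: real
  assume "0 < e"
  then have e: "0 < e / 2" by simp
  have gs: "(\<lambda>n. g (s n)) \<longlonglongrightarrow> g l"
    using continuous_on_tendsto_compose[OF cont s(2,3)] s(1) by simp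
  have "\<forall>\<^sub>F n in sequentially. dist (f n (s n)) (g l) < e"
    using uniform_limitD[OF unif e] tendstoD[OF gs e]
  proof eventually_elim
    case (elim n)
    then have "dist (f n (s n)) (g (s n)) < e / 2" using s(1) by blast
    with elim(2) show ?case by metric
  qed
  then show "\<exists>N. \<forall>n\<ge>N. dist (f n (s n)) (g l) < e"
    by (simp add: eventually_sequentially)
qed

lemma compact_closure_bounded_times:
  assumes luus: "LUUS G" and cont: "composed_of_continuous G"
    and qi: "quasi_invariant G A" and comp: "compact (A t)"
  shows "compact (closure (\<Union>s\<in>{t..T}. A s))"
proof (rule compact_closure_if_sequences)
  fix x :: "nat \<Rightarrow> 'a"
  assume "\<And>n. x n \<in> (\<Union>s\<in>{t..T}. A s)"
  then obtain s where s: "\<And>n. s n \<in> {t..T}" "\<And>n. x n \<in> A (s n)"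
    by (simp only: UN_iff Bex_def) metis
  have "\<exists>\<psi>. complete_orbit G (x n) (s n) \<psi> \<and> (\<forall>u. \<psi> u \<in> A u)" for n
    using qi s(2) unfolding quasi_invariant_def by blast
  then have "\<forall>n. \<exists>\<psi>. complete_orbit G (x n) (s n) \<psi> \<and> (\<forall>u. \<psi> u \<in> A u)" ..
  from choice[OF this] obtain \<psi> where
    \<psi>: "\<And>n. complete_orbit G (x n) (s n) (\<psi> n)" "\<And>n u. \<psi> n u \<in> A u"
    by blast
  \<comment> \<open>LUUS compares solutions with one common initial time, so all orbits are cut off
    at \<open>t\<close> rather than at their own times \<open>s n\<close>.\<close>
  define \<phi> where "\<phi> n = restrict (\<psi> n) {t..}" for n
  have \<phi>_G: "\<phi> n \<in> G t" for n
    \<comment> \<open>The shift \<open>t - s n\<close> is nonpositive: a complete orbit may also be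
      restricted from a time before its base point.\<close>
    using \<psi>(1)[of n, unfolded complete_orbit_def, THEN conjunct2, THEN spec, of "t - s n"]
    by (simp add: \<phi>_def)
  have \<phi>_s: "\<phi> n (s n) = x n" for n
    using \<psi>(1)[of n] s(1)[of n] by (simp add: complete_orbit_def \<phi>_def)
  have \<phi>_t: "\<phi> n t \<in> A t" for n
    using \<psi>(2) by (simp add: \<phi>_def)
  \<comment> \<open>Three nested subsequences follow: \<open>p\<close> makes the initial values in
    \<open>A t\<close> converge, as LUUS requires, \<open>q\<close> the times, and \<open>r\<close>
    the solutions.\<close>
  obtain z p where p: "strict_mono p" "((\<lambda>n. \<phi> n t) \<circ> p) \<longlonglongrightarrow> z"
    using comp[unfolded compact_def, THEN spec, of "\<lambda>n. \<phi> n t"] \<phi>_t by blast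
  obtain \<sigma> q where q: "strict_mono q" "((s \<circ> p) \<circ> q) \<longlonglongrightarrow> \<sigma>" and \<sigma>: "\<sigma> \<in> {t..T}"
    using compact_Icc[of t T, unfolded compact_def, THEN spec, of "s \<circ> p"] s(1)
    by (simp only: o_apply) blast
  have "(\<lambda>j. \<phi> (p (q j)) t) \<longlonglongrightarrow> z"
    using LIMSEQ_subseq_LIMSEQ[OF p(2) q(1)] by (simp add: o_def)
  then obtain \<phi>' r where \<phi>': "\<phi>' \<in> G t" and r: "strict_mono r"
    and unif: "\<And>K. compact K \<Longrightarrow> K \<subseteq> {t..} \<Longrightarrow>
      uniform_limit K (\<lambda>k. \<phi> (p (q (r k)))) \<phi>' sequentially"
    using luus[unfolded LUUS_def, rule_format, of "\<lambda>j. \<phi> (p (q j))" t z] \<phi>_G by blast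
  \<comment> \<open>The limit is itself a solution in \<open>G t\<close>, hence continuous.\<close>
  have "continuous_on {t..T} \<phi>'"
    using cont \<phi>' unfolding composed_of_continuous_def
    by (auto intro!: continuous_on_subset[of "{t..}" \<phi>' "{t..T}"])
  moreover have "(\<lambda>k. s (p (q (r k)))) \<longlonglongrightarrow> \<sigma>"
    using LIMSEQ_subseq_LIMSEQ[OF q(2) r] by (simp add: o_def)
  ultimately have "(\<lambda>k. \<phi> (p (q (r k))) (s (p (q (r k))))) \<longlonglongrightarrow> \<phi>' \<sigma>"
    using s(1) \<sigma> by (intro uniform_limit_tendsto_diagonal[OF unif[of "{t..T}"]]) auto
  then have "(x \<circ> (p \<circ> q \<circ> r)) \<longlonglongrightarrow> \<phi>' \<sigma>"
    by (simp add: \<phi>_s o_def)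
  moreover have "strict_mono (p \<circ> q \<circ> r)"
    using p(1) q(1) r by (simp add: strict_mono_def)
  ultimately show "\<exists>l r. strict_mono (r :: nat \<Rightarrow> nat) \<and> (x \<circ> r) \<longlonglongrightarrow> l"
    by blast
qed

theorem theorem16:
  fixes G :: "real \<Rightarrow> (real \<Rightarrow> 'a::complete_space) set"
    and A :: "real \<Rightarrow> 'a set"
    and S :: "(real \<Rightarrow> 'a) set"
    and A_inf :: "'a set"
  assumes "generalized_process G"
    and "LUUS G"
    and "composed_of_continuous G"
    and "global_selected_pullback_attractor G A"
    and "quasi_invariant G A"
    and "autonomous_problem S"
    and "asymptotically_autonomous G A S"
    and "global_attractor S A_inf"
    and "((\<lambda>t. hsemidist (A t) A_inf) \<longlongrightarrow> 0) at_top"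
  shows "forward_compact A"
  unfolding forward_compact_def
proof (intro allI compact_closure_if_near_compact)
  fix t e :: real
  assume "0 < e"
  then have "\<forall>\<^sub>F s in at_top. hsemidist (A s) A_inf < ennreal e"
    using order_tendstoD(2)[OF assms(9)] by simp
  then obtain T where T: "\<And>s. s \<ge> T \<Longrightarrow> hsemidist (A s) A_inf < ennreal e"
    unfolding eventually_at_top_linorder by blast
  \<comment> \<open>\<open>T\<close>, and with it \<open>K\<close>, depends on \<open>e\<close>. If
    \<open>T < t\<close>, the first part is empty and \<open>A_inf\<close> alone serves.\<close>
  define K where "K = closure (\<Union>s\<in>{t..T}. A s) \<union> A_inf"
  have "compact (A t)"
    using assms(4) by (simp add: global_selected_pullback_attractor_def)
  then have "compact K"
    using compact_closure_bounded_times[OF assms(2,3,5)] assms(8)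
    by (auto simp: K_def global_attractor_def)
  moreover have "\<exists>k\<in>K. dist u k < e" if "s \<ge> t" "u \<in> A s" for s u
  proof (cases "s \<le> T")
    case True
    then have "u \<in> K"
      using that closure_subset unfolding K_def by fastforce
    then show ?thesis using \<open>0 < e\<close> by (metis dist_self)
  next
    case False
    then obtain k where "k \<in> A_inf" "dist u k < e"
      using hsemidist_lessD[OF T \<open>u \<in> A s\<close>] by auto
    then show ?thesis by (auto simp: K_def)
  qed
  ultimately show "\<exists>K. compact K \<and> (\<forall>u\<in>\<Union>s\<in>{t..}. A s. \<exists>k\<in>K. dist u k < e)"
    by auto
qed

end
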